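(* Let $W$ be an $m\times n$ stochastic matrix, not all of whose rows are equal and none of whose columns is identically zero, and let $\hat p$ be a common final output with $\hat p_i>0$ for all $i$, as in the context. For fixed $g$, the global rate $\tilde R(r,g)$ (see context) decreases in $r/(1-r_+)$; that is, for all $r,\tilde r$ such that $(r,g)$ and $(\tilde r,g)$ are both $g$-admissible, $$\frac{r}{1-r_+}\ \ge\ \frac{\tilde r}{1-\tilde r_+}\quad\Longrightarrow\quad \tilde R(r,g)\le\tilde R(\tilde r,g),$$ where the inequality between vectors is entrywise.
   Context: Vectors are row vectors except that $1_m$, $1_n$ denote the column vectors of ones; $I_m$ is the identity matrix; inequalities between vectors or matrices are entrywise; $W_i$ is the $i$th row of a matrix $W$. A matrix is stochastic if it has nonnegative entries and all row sums equal to 1. $\Omega=\{p\in\mathbf{R}^{1\times m}: p\ge 0,\ p1_m=1\}$ and $\Omega(r)=\{p\in\Omega: p\ge r\}$. Logarithms are natural, $0\log 0=0$, and $H(q)=-\sum_i q_i\log q_i$ for a nonnegative vector $q$. Admissible pair: nonnegative vectors $r$ ($1\times m$) and $f$ ($1\times n$), with $r_+=r1_m$, $f_+=f1_n$, such that $r_+<1$ and $$\tilde W:=(1+f_+)\frac{I_m-1_m r}{1-r_+}W-1_m f\ \ge 0$$ (then $\tilde W$ is stochastic). The associated vector $c$ is $c_i=H(\tilde W_i)-\frac{1+f_+}{1-r_+}H(W_i)$. Algorithm III with parameters $(r,f)$: choose $p^{(0)}\in\Omega(r)$ with $p^{(0)}_i>0$ for all $i$, and iterate $p^{(t+1)}=M(p^{(t)})$,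 where for $p$ with positive entries $$M_i(p)=\max\Big\{r_i,\ \alpha\exp\Big(c_i+\sum_j\tilde W_{ij}\log\Phi_{ji}(p)\Big)\Big\},\qquad \Phi_{ji}(p)=\frac{p_i\tilde W_{ij}}{f_j+\sum_l p_l\tilde W_{lj}},$$ and $\alpha=\alpha(p)>0$ is chosen so that $\sum_i M_i(p)=1$ (terms with $\tilde W_{ij}=0$ contribute $0$). If $p^{(t)}\to p^*$, the final output is $\hat p=(p^*-r)/(1-r_+)$; it maximizes $\sum_i p_i\sum_j W_{ij}\log(W_{ij}/(pW)_j)$ over $p\in\Omega$. Standing assumption: the algorithms under comparison all deliver the same final output $\hat p$, with $\hat p_i>0$ for all $i$; so for parameters $(r,f)$ the limit is $p^*=(1-r_+)\hat p+r$, which satisfies $p^*_i>r_i$ for all $i$ and $M(p^* )=p^*$. The matrix rate is the $m\times m$ matrix $R(p^* )$ with $(k,i)$ entry $\partial M_i/\partial p_k$ at $p^*$ ($p_1,\dots,p_m$ treated as independent variables), and the global rate of convergence $R(r,f)$ is the spectral radius of $R(p^* )$ for parameters $(r,f)$. Reparameterization: for an admissible pair $(r,f)$ put $g=\frac{1+f_+}{1-r_+}rW+f$; then, with $g_+=g1_n$, $f$ is recovered as $f=g-(1+g_+)rW$. A pair $(r,g)$ is called $g$-admissible if it arises in this way from an admissible pair $(r,f)$, and then $\tilde R(r,g):=R(r,f)$. *)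

theory Defs
  imports "HOL-Analysis.Analysis"
begin

text \<open>
  Row vectors are elements of \<open>real ^ 'n\<close>, acting on matrices by \<open>v*\<close>; the order \<open>\<le>\<close> on vectors and
  matrices is the entrywise one. \<open>entry_sum x\<close> is the entry sum of \<open>x\<close>, written \<open>x\<^sub>+\<close> in comments.
\<close>

definition entry_sum :: "real ^ 'n \<Rightarrow> real" where
  "entry_sum x = (\<Sum>i\<in>UNIV. x $ i)"

definition stochastic :: "real ^ 'n ^ 'm \<Rightarrow> bool" where
  "stochastic W \<longleftrightarrow> 0 \<le> W \<and> (\<forall>i. entry_sum (W $ i) = 1)"

definition prob_simplex :: "(real ^ 'm) set" where
  "prob_simplex = {p. 0 \<le> p \<and> entry_sum p = 1}"

definition prob_simplex_ge :: "real ^ 'm \<Rightarrow> (real ^ 'm) set" where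
  "prob_simplex_ge r = {p \<in> prob_simplex. r \<le> p}"

text \<open>Natural logarithm; \<open>0 * ln 0 = 0\<close> holds by the type's arithmetic.\<close>

definition shannon :: "real ^ 'n \<Rightarrow> real" where
  "shannon q = - (\<Sum>i\<in>UNIV. q $ i * ln (q $ i))"

text \<open>The matrix \<open>1 v\<close>: every row equals \<open>v\<close>.\<close>

definition const_rows :: "real ^ 'n \<Rightarrow> real ^ 'n ^ 'm" where
  "const_rows v = (\<chi> i. v)"

definition W_tilde :: "real ^ 'n ^ 'm \<Rightarrow> real ^ 'm \<Rightarrow> real ^ 'n \<Rightarrow> real ^ 'n ^ 'm" where
  "W_tilde W r f =
     ((1 + entry_sum f) / (1 - entry_sum r)) *\<^sub>R ((mat 1 - const_rows r) ** W) - const_rows f"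

definition admissible :: "real ^ 'n ^ 'm \<Rightarrow> real ^ 'm \<Rightarrow> real ^ 'n \<Rightarrow> bool" where
  "admissible W r f \<longleftrightarrow> 0 \<le> r \<and> 0 \<le> f \<and> entry_sum r < 1 \<and> 0 \<le> W_tilde W r f"

definition c_coeff :: "real ^ 'n ^ 'm \<Rightarrow> real ^ 'm \<Rightarrow> real ^ 'n \<Rightarrow> 'm \<Rightarrow> real" where
  "c_coeff W r f i =
     shannon (W_tilde W r f $ i) - (1 + entry_sum f) / (1 - entry_sum r) * shannon (W $ i)"

definition Phi :: "real ^ 'n ^ 'm \<Rightarrow> real ^ 'm \<Rightarrow> real ^ 'n \<Rightarrow> real ^ 'm \<Rightarrow> 'n \<Rightarrow> 'm \<Rightarrow> real" where
  "Phi W r f p j i =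
     p $ i * W_tilde W r f $ i $ j / (f $ j + (\<Sum>l\<in>UNIV. p $ l * W_tilde W r f $ l $ j))"

text \<open>
  The unnormalised weight; summands with \<open>W_tilde W r f $ i $ j = 0\<close> vanish because of that factor.
\<close>

definition weight :: "real ^ 'n ^ 'm \<Rightarrow> real ^ 'm \<Rightarrow> real ^ 'n \<Rightarrow> real ^ 'm \<Rightarrow> 'm \<Rightarrow> real" where
  "weight W r f p i =
     exp (c_coeff W r f i + (\<Sum>j\<in>UNIV. W_tilde W r f $ i $ j * ln (Phi W r f p j i)))"

text \<open>
  The normalising constant exists and is unique whenever \<open>0 \<le> r\<close> and \<open>r\<^sub>+ < 1\<close>: the sum below is
  continuous in \<open>a\<close>, tends to \<open>r\<^sub>+\<close> as \<open>a\<close> tends to \<open>0\<close>, is unbounded, and is strictly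
  increasing where it exceeds \<open>r\<^sub>+\<close>.
\<close>

definition alpha :: "real ^ 'n ^ 'm \<Rightarrow> real ^ 'm \<Rightarrow> real ^ 'n \<Rightarrow> real ^ 'm \<Rightarrow> real" where
  "alpha W r f p = (THE a. 0 < a \<and> (\<Sum>i\<in>UNIV. max (r $ i) (a * weight W r f p i)) = 1)"

definition M_map :: "real ^ 'n ^ 'm \<Rightarrow> real ^ 'm \<Rightarrow> real ^ 'n \<Rightarrow> real ^ 'm \<Rightarrow> real ^ 'm" where
  "M_map W r f p = (\<chi> i. max (r $ i) (alpha W r f p * weight W r f p i))"

text \<open>Some run of the algorithm converges and delivers \<open>phat\<close>.\<close>

definition final_output :: "real ^ 'n ^ 'm \<Rightarrow> real ^ 'm \<Rightarrow> real ^ 'n \<Rightarrow> real ^ 'm \<Rightarrow> bool" where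
  "final_output W r f phat \<longleftrightarrow>
     (\<exists>p0 pstar. p0 \<in> prob_simplex_ge r \<and> (\<forall>i. 0 < p0 $ i) \<and>
        (\<lambda>t. (M_map W r f ^^ t) p0) \<longlonglongrightarrow> pstar \<and>
        phat = (1 / (1 - entry_sum r)) *\<^sub>R (pstar - r))"

text \<open>
  The rate matrix at \<open>p\<close>: row index \<open>k\<close> is the variable of differentiation, and the coordinates
  vary independently, so the perturbed points leave the simplex.
\<close>

definition matrix_rate :: "real ^ 'n ^ 'm \<Rightarrow> real ^ 'm \<Rightarrow> real ^ 'n \<Rightarrow> real ^ 'm \<Rightarrow> real ^ 'm ^ 'm" where
  "matrix_rate W r f p =
     (\<chi> k i. deriv (\<lambda>x. M_map W r f (\<chi> l. if l = k then x else p $ l) $ i) (p $ k))"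

text \<open>
  Complex eigenvalues of a real matrix. There are finitely many and at least one, so the
  supremum in the spectral radius is a maximum.
\<close>

definition spectrum :: "real ^ 'm ^ 'm \<Rightarrow> complex set" where
  "spectrum A = {z. \<exists>v. v \<noteq> 0 \<and> map_matrix complex_of_real A *v v = z *s v}"

definition spectral_radius :: "real ^ 'm ^ 'm \<Rightarrow> real" where
  "spectral_radius A = (SUP z\<in>spectrum A. cmod z)"

definition global_rate :: "real ^ 'n ^ 'm \<Rightarrow> real ^ 'm \<Rightarrow> real ^ 'm \<Rightarrow> real ^ 'n \<Rightarrow> real" where
  "global_rate W phat r f =
     spectral_radius (matrix_rate W r f ((1 - entry_sum r) *\<^sub>R phat + r))"

definition g_of :: "real ^ 'n ^ 'm \<Rightarrow> real ^ 'm \<Rightarrow> real ^ 'n \<Rightarrow> real ^ 'n" where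
  "g_of W r f = ((1 + entry_sum f) / (1 - entry_sum r)) *\<^sub>R (r v* W) + f"

definition f_of :: "real ^ 'n ^ 'm \<Rightarrow> real ^ 'm \<Rightarrow> real ^ 'n \<Rightarrow> real ^ 'n" where
  "f_of W r g = g - (1 + entry_sum g) *\<^sub>R (r v* W)"

definition g_admissible :: "real ^ 'n ^ 'm \<Rightarrow> real ^ 'm \<Rightarrow> real ^ 'n \<Rightarrow> bool" where
  "g_admissible W r g \<longleftrightarrow> (\<exists>f. admissible W r f \<and> g = g_of W r f)"

definition global_rate_g :: "real ^ 'n ^ 'm \<Rightarrow> real ^ 'm \<Rightarrow> real ^ 'm \<Rightarrow> real ^ 'n \<Rightarrow> real" where
  "global_rate_g W phat r g = global_rate W phat r (f_of W r g)"

lemma entry_sum_vector_matrix: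
  assumes "stochastic W"
  shows "entry_sum (r v* W) = entry_sum r"
proof -
  have "entry_sum (r v* W) = (\<Sum>i\<in>UNIV. \<Sum>j\<in>UNIV. r $ i * W $ i $ j)"
    unfolding entry_sum_def vector_matrix_mult_def by (subst sum.swap) simp
  also have "\<dots> = (\<Sum>i\<in>UNIV. r $ i * entry_sum (W $ i))"
    by (simp add: entry_sum_def sum_distrib_left)
  finally show ?thesis
    using assms by (simp add: stochastic_def entry_sum_def)
qed

lemma f_of_g_of:
  assumes "stochastic W" and "entry_sum r < 1"
  shows "f_of W r (g_of W r f) = f"
proof -
  have "entry_sum (g_of W r f) = (1 + entry_sum f) / (1 - entry_sum r) * entry_sum (r v* W) + entry_sum f"
    by (simp add: g_of_def entry_sum_def sum.distrib sum_distrib_left)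
  then have "1 + entry_sum (g_of W r f) = (1 + entry_sum f) / (1 - entry_sum r)"
    using assms by (simp add: entry_sum_vector_matrix field_simps)
  then show ?thesis
    by (simp add: f_of_def g_of_def)
qed

end

theory Submission
  imports Defs
begin

text \<open>
  Write \<open>a = 1 + g\<^sub>+\<close>, \<open>q = phat W\<close>, \<open>P = phat + r / (1 - r\<^sub>+)\<close>. The modified channel is \<open>a W - 1 g\<close>, so \<open>r\<close> enters
  the rate matrix only through \<open>P\<close>: it equals \<open>I - N\<close> where \<open>N\<close> is row stochastic and, modulo the constant
  vectors, acts like \<open>S (diag P - P P\<^sup>T / P\<^sub>+)\<close> with \<open>S = a W diag(1/q) W\<^sup>T\<close> positive semidefinite.
  Apart from the eigenvalue 1, the eigenvalues of \<open>N\<close> are therefore the critical values of the quotient of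
  \<open>y S y\<^sup>T\<close> by \<open>\<Sum>i. y\<^sub>i\<^sup>2 / P\<^sub>i\<close> on the vectors with entry sum 0; they lie in \<open>[0, 1]\<close>. The denominator
  decreases in \<open>P\<close>, so the smallest of these values increases in \<open>P\<close>, and the spectral radius of \<open>I - N\<close> is
  1 minus that value.
\<close>

section \<open>Spectral comparison\<close>

text \<open>At a coordinate where the modulus of \<open>v\<close> is maximal, the eigenvalue
  equation writes \<open>\<mu> * v $ k\<close> as a convex combination of numbers of no larger
  modulus.\<close>

lemma row_stochastic_eigenvalue_le_1:
  fixes N :: "real ^ 'm ^ 'm" and v :: "complex ^ 'm"
  assumes nonneg: "\<And>k i. 0 \<le> N $ k $ i"
    and sum1: "\<And>k. (\<Sum>i\<in>UNIV. N $ k $ i) = 1"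
    and "v \<noteq> 0"
    and eig: "\<And>k. (\<Sum>i\<in>UNIV. of_real (N $ k $ i) * v $ i) = \<mu> * v $ k"
  shows "cmod \<mu> \<le> 1"
proof -
  obtain k where k: "\<And>i. cmod (v $ i) \<le> cmod (v $ k)"
  proof -
    have fin: "finite (range (\<lambda>i. cmod (v $ i)))" by simp
    then have "Max (range (\<lambda>i. cmod (v $ i))) \<in> range (\<lambda>i. cmod (v $ i))"
      by (intro Max_in) auto
    then obtain k where "Max (range (\<lambda>i. cmod (v $ i))) = cmod (v $ k)" by blast
    with fin show ?thesis by (metis that Max_ge rangeI)
  qed
  obtain l where "v $ l \<noteq> 0" using \<open>v \<noteq> 0\<close> by (auto simp: vec_eq_iff)
  then have pos: "0 < cmod (v $ k)"
    using k[of l] by (smt (verit) zero_less_norm_iff)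
  have "cmod \<mu> * cmod (v $ k) = cmod (\<Sum>i\<in>UNIV. of_real (N $ k $ i) * v $ i)"
    by (simp add: eig norm_mult)
  also have "\<dots> \<le> (\<Sum>i\<in>UNIV. N $ k $ i * cmod (v $ i))"
    by (rule order_trans[OF norm_sum]) (simp add: norm_mult nonneg)
  also have "\<dots> \<le> (\<Sum>i\<in>UNIV. N $ k $ i * cmod (v $ k))"
    by (intro sum_mono mult_left_mono k nonneg)
  also have "\<dots> = cmod (v $ k)"
    by (simp add: sum1 flip: sum_distrib_right)
  finally show ?thesis using pos by simp
qed

section \<open>Rayleigh quotients on the vectors with entry sum 0\<close>

lemma quadratic_nonneg_imp_linear_zero:
  fixes b c :: real
  assumes "\<And>t. 0 \<le> 2 * t * b + t\<^sup>2 * c"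
  shows "b = 0"
proof (rule ccontr)
  assume "b \<noteq> 0"
  \<comment> \<open>So small a step against the sign of \<open>b\<close> that the quadratic term is
    at most \<open>- t * b\<close>, which leaves \<open>0 \<le> t * b\<close>.\<close>
  define t where "t = - b / (\<bar>c\<bar> + 1)"
  have "t\<^sup>2 * c \<le> t\<^sup>2 * (\<bar>c\<bar> + 1)" by (intro mult_left_mono) auto
  also have "\<dots> = - t * b" by (simp add: t_def power2_eq_square)
  finally have "0 \<le> t * b" using assms[of t] by simp
  moreover have "t * b < 0"
    using \<open>b \<noteq> 0\<close> by (simp add: t_def divide_less_0_iff zero_less_mult_iff add_nonneg_pos flip: power2_eq_square)
  ultimately show False by simp
qed

text \<open>The quotient of the two quadratic forms attains its minimum \<open>\<nu>\<close> on the
  compact set of zero-sum unit vectors, and the first variation vanishes there. The constant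
  \<open>c\<close> is the Lagrange multiplier of the zero-sum constraint. Two distinct indices
  ensure that a nonzero zero-sum vector exists.\<close>

lemma min_generalized_eigenvector_on_zero_sum:
  fixes S :: "real ^ 'm ^ 'm" and P :: "real ^ 'm"
  assumes sym: "transpose S = S" and P: "\<And>i. 0 < P $ i"
    and "k \<noteq> (l::'m)"
  obtains y \<nu> c where "y \<noteq> 0" "entry_sum y = 0"
    "\<forall>i. (S *v y) $ i = \<nu> * (y $ i / P $ i) + c"
    "\<forall>x. entry_sum x = 0 \<longrightarrow> \<nu> * (\<Sum>i\<in>UNIV. (x $ i)\<^sup>2 / P $ i) \<le> x \<bullet> (S *v x)"
    "\<nu> * (\<Sum>i\<in>UNIV. (y $ i)\<^sup>2 / P $ i) = y \<bullet> (S *v y)"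
proof -
  define K where "K x = (\<Sum>i\<in>UNIV. (x $ i)\<^sup>2 / P $ i)" for x :: "real ^ 'm"
  define A :: "(real ^ 'm) set" where "A = sphere 0 1 \<inter> {x. entry_sum x = 0}"
  have Kpos: "0 < K x" if nz: "x \<noteq> 0" for x
  proof -
    obtain i where "x $ i \<noteq> 0" using nz by (auto simp: vec_eq_iff)
    then show ?thesis unfolding K_def
      by (intro sum_pos2[of _ i]) (auto intro!: divide_pos_pos divide_nonneg_pos P)
  qed
  have K_scale: "K (t *\<^sub>R x) = t\<^sup>2 * K x" for t x
    by (simp add: K_def sum_distrib_left power_mult_distrib)
  have S_scale: "(t *\<^sub>R x) \<bullet> (S *v (t *\<^sub>R x)) = t\<^sup>2 * (x \<bullet> (S *v x))" for t x
    by (simp add: matrix_vector_mult_scaleR power2_eq_square)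
  have es_scale: "entry_sum (t *\<^sub>R x) = t * entry_sum x" for t and x :: "real ^ 'm"
    by (simp add: entry_sum_def sum_distrib_left)
  have es_add: "entry_sum (x + y) = entry_sum x + entry_sum y" for x y :: "real ^ 'm"
    by (simp add: entry_sum_def sum.distrib)
  have es_axis: "entry_sum (axis i (1::real)) = 1" for i :: 'm
    by (simp add: entry_sum_def axis_def)
  define w :: "real ^ 'm" where "w = axis k 1 + (-1) *\<^sub>R axis l 1"
  have w: "w \<noteq> 0" "entry_sum w = 0"
  proof -
    have "w $ k = 1" using \<open>k \<noteq> l\<close> by (simp add: w_def axis_def)
    then show "w \<noteq> 0" by auto
    show "entry_sum w = 0" unfolding w_def es_add es_scale es_axis by simp
  qed
  have "compact A"
    unfolding A_def entry_sum_def
    by (intro compact_Int_closed compact_sphere closed_Collect_eq continuous_intros)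
  moreover have "(1 / norm w) *\<^sub>R w \<in> A"
    using w by (simp add: A_def es_scale)
  moreover have "continuous_on A (\<lambda>x. (x \<bullet> (S *v x)) / K x)"
  proof (intro continuous_intros)
    show "continuous_on A K" unfolding K_def
      by (intro continuous_intros) (use P in \<open>auto simp: less_imp_neq[symmetric]\<close>)
    show "\<forall>x\<in>A. K x \<noteq> 0"
    proof
      fix x assume "x \<in> A"
      then have "x \<noteq> 0" by (auto simp: A_def)
      from Kpos[OF this] show "K x \<noteq> 0" by simp
    qed
  qed
  ultimately obtain y where y: "y \<in> A"
    and ymin: "\<And>x. x \<in> A \<Longrightarrow> (y \<bullet> (S *v y)) / K y \<le> (x \<bullet> (S *v x)) / K x"
    using continuous_attains_inf[of A "\<lambda>x. (x \<bullet> (S *v x)) / K x"] by blast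
  define \<nu> where "\<nu> = (y \<bullet> (S *v y)) / K y"
  have y0: "y \<noteq> 0" "entry_sum y = 0" using y by (auto simp: A_def)
  have eq: "\<nu> * K y = y \<bullet> (S *v y)" using Kpos[OF y0(1)] by (simp add: \<nu>_def)
  \<comment> \<open>Both forms are homogeneous of degree 2, so the bound passes from unit vectors to
    the whole hyperplane.\<close>
  have min: "\<nu> * K x \<le> x \<bullet> (S *v x)" if "entry_sum x = 0" for x
  proof (cases "x = 0")
    case True then show ?thesis by (simp add: K_def)
  next
    case False
    have "(1 / norm x) *\<^sub>R x \<in> A" using that False by (simp add: A_def es_scale)
    from ymin[OF this] have "\<nu> \<le> (x \<bullet> (S *v x)) / K x"
      unfolding K_scale S_scale \<nu>_def using False by simp
    then show ?thesis using Kpos[OF False] by (simp add: field_simps)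
  qed
  \<comment> \<open>Half the gradient at \<open>y\<close> of the form
    \<open>x \<bullet> (S *v x) - \<nu> * K x\<close>, which is nonnegative on the hyperplane and
    vanishes at \<open>y\<close>.\<close>
  define d where "d = (\<chi> i. (S *v y) $ i - \<nu> * (y $ i / P $ i))"
  have orth: "z \<bullet> d = 0" if z: "entry_sum z = 0" for z
  proof (rule quadratic_nonneg_imp_linear_zero)
    fix t :: real
    have sym': "y \<bullet> (S *v z) = z \<bullet> (S *v y)"
      by (metis sym dot_lmul_matrix inner_commute transpose_matrix_vector)
    have 1: "(y + t *\<^sub>R z) \<bullet> (S *v (y + t *\<^sub>R z))
        = y \<bullet> (S *v y) + 2 * t * (z \<bullet> (S *v y)) + t\<^sup>2 * (z \<bullet> (S *v z))"
      by (simp add: matrix_vector_mult_scaleR matrix_vector_right_distrib inner_add sym' power2_eq_square algebra_simps)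
    have 2: "K (y + t *\<^sub>R z) = K y + 2 * t * (\<Sum>i\<in>UNIV. z $ i * (y $ i / P $ i)) + t\<^sup>2 * K z"
      unfolding K_def sum_distrib_left sum.distrib[symmetric]
      by (intro sum.cong refl) (simp add: power2_sum add_divide_distrib power_mult_distrib algebra_simps)
    have 3: "z \<bullet> d = z \<bullet> (S *v y) - \<nu> * (\<Sum>i\<in>UNIV. z $ i * (y $ i / P $ i))"
      by (simp add: d_def inner_vec_def sum_subtractf right_diff_distrib sum_distrib_left algebra_simps)
    have "entry_sum (y + t *\<^sub>R z) = 0" by (simp add: es_add es_scale y0 z)
    from min[OF this] show "0 \<le> 2 * t * (z \<bullet> d) + t\<^sup>2 * (z \<bullet> (S *v z) - \<nu> * K z)"
      unfolding 1 2 3 using eq by (simp add: algebra_simps)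
  qed
  \<comment> \<open>A vector orthogonal to all differences of unit vectors has equal
    entries.\<close>
  have const: "d $ i = d $ k" for i
  proof -
    have "(axis i 1 + (-1) *\<^sub>R axis k 1) \<bullet> d = 0"
      by (rule orth) (unfold es_add es_scale es_axis, simp)
    then show ?thesis by (simp add: inner_diff_left inner_axis inner_axis')
  qed
  show thesis
  proof (rule that[OF y0])
    show "\<forall>i. (S *v y) $ i = \<nu> * (y $ i / P $ i) + d $ k"
    proof
      show "(S *v y) $ i = \<nu> * (y $ i / P $ i) + d $ k" for i
        using const[of i] by (simp add: d_def)
    qed
  qed (use min eq in \<open>simp_all add: K_def\<close>)
qed

text \<open>Center \<open>v\<close> by its \<open>P\<close>-weighted mean and multiply by
  \<open>P\<close>: the resulting \<open>z\<close> has sum 0, and \<open>S\<close> maps it to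
  \<open>\<mu> * z / P\<close> plus a constant vector. Pairing with the conjugate of
  \<open>z\<close> removes the constant. Since \<open>N\<close> need not be symmetric,
  \<open>v\<close> may be complex; \<open>x\<close> and \<open>y\<close> are the real and imaginary
  parts of \<open>z\<close>, and the resulting equation shows that \<open>\<mu>\<close> is
  real.\<close>

lemma eigenvalue_as_rayleigh_quotient:
  fixes S :: "real ^ 'm ^ 'm" and P e h :: "real ^ 'm" and v :: "complex ^ 'm"
  assumes sym: "transpose S = S" and P: "\<And>i. 0 < P $ i"
    and N: "\<And>k i. N $ k $ i = P $ i * (S $ k $ i - e $ k - h $ i)"
    and sum1: "\<And>k. (\<Sum>i\<in>UNIV. N $ k $ i) = 1"
    and "v \<noteq> 0"
    and eig: "\<And>k. (\<Sum>i\<in>UNIV. of_real (N $ k $ i) * v $ i) = \<mu> * v $ k"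
    and "\<mu> \<noteq> 1"
  obtains x y where "entry_sum x = 0" "entry_sum y = 0"
    "0 < (\<Sum>i\<in>UNIV. (x $ i)\<^sup>2 / P $ i) + (\<Sum>i\<in>UNIV. (y $ i)\<^sup>2 / P $ i)"
    "\<mu> * of_real ((\<Sum>i\<in>UNIV. (x $ i)\<^sup>2 / P $ i) + (\<Sum>i\<in>UNIV. (y $ i)\<^sup>2 / P $ i))
       = of_real (x \<bullet> (S *v x) + y \<bullet> (S *v y))"
proof -
  define t where "t = (\<Sum>i\<in>UNIV. of_real (P $ i) * v $ i) / of_real (\<Sum>i\<in>UNIV. P $ i)"
  define u where "u i = v $ i - t" for i
  define z where "z i = of_real (P $ i) * u i" for i
  define x :: "real ^ 'm" where "x = (\<chi> i. Re (z i))"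
  define y :: "real ^ 'm" where "y = (\<chi> i. Im (z i))"
  have Psum: "0 < (\<Sum>i\<in>UNIV. P $ i)" by (intro sum_pos P) auto
  have "(\<Sum>i\<in>UNIV. z i) = (\<Sum>i\<in>UNIV. of_real (P $ i) * v $ i) - of_real (\<Sum>i\<in>UNIV. P $ i) * t"
    by (simp add: z_def u_def right_diff_distrib sum_subtractf flip: sum_distrib_right)
  also have "\<dots> = 0" using Psum by (simp add: t_def del: of_real_sum)
  finally have z0: "(\<Sum>i\<in>UNIV. z i) = 0" .
  have x0: "entry_sum x = 0" using arg_cong[OF z0, of Re] by (simp add: x_def entry_sum_def Re_sum)
  have y0: "entry_sum y = 0" using arg_cong[OF z0, of Im] by (simp add: y_def entry_sum_def Im_sum)
  \<comment> \<open>Otherwise \<open>v\<close> is constant, and unit row sums force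
    \<open>\<mu> = 1\<close>.\<close>
  obtain i0 where "u i0 \<noteq> 0"
  proof (rule ccontr)
    assume "\<not> thesis"
    with that have v: "v $ i = t" for i by (auto simp: u_def)
    have "t = \<mu> * t" using eig[of undefined] sum1[of undefined]
      by (simp add: v flip: sum_distrib_right of_real_sum)
    with \<open>\<mu> \<noteq> 1\<close> have "t = 0" by simp
    with v \<open>v \<noteq> 0\<close> show False by (simp add: vec_eq_iff)
  qed
  then have z_i0: "z i0 \<noteq> 0" using P[of i0] by (simp add: z_def)
  have Kz: "(\<Sum>i\<in>UNIV. (x $ i)\<^sup>2 / P $ i) + (\<Sum>i\<in>UNIV. (y $ i)\<^sup>2 / P $ i) = (\<Sum>i\<in>UNIV. (cmod (z i))\<^sup>2 / P $ i)"
    by (simp add: x_def y_def cmod_power2 add_divide_distrib sum.distrib)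
  have pos: "0 < (\<Sum>i\<in>UNIV. (cmod (z i))\<^sup>2 / P $ i)"
    by (rule sum_pos2[of _ i0]) (use z_i0 P in \<open>auto intro!: divide_pos_pos divide_nonneg_pos\<close>)
  \<comment> \<open>The term with \<open>e\<close> drops out because \<open>z\<close> sums to 0, and
    the term with \<open>h\<close> does not depend on \<open>k\<close>; so everything beyond
    \<open>\<mu> * u k\<close> is constant in \<open>k\<close>.\<close>
  have Sz: "(\<Sum>i\<in>UNIV. of_real (S $ k $ i) * z i) = \<mu> * u k + ((\<mu> - 1) * t + (\<Sum>i\<in>UNIV. of_real (h $ i) * z i))" for k
  proof -
    have 1: "(\<Sum>i\<in>UNIV. of_real (N $ k $ i) * u i) = \<mu> * v $ k - t"
      using eig[of k] sum1[of k]
      by (simp add: u_def right_diff_distrib sum_subtractf flip: sum_distrib_right of_real_sum)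
    have 2: "(\<Sum>i\<in>UNIV. of_real (N $ k $ i) * u i)
       = (\<Sum>i\<in>UNIV. of_real (S $ k $ i) * z i) - of_real (e $ k) * (\<Sum>i\<in>UNIV. z i) - (\<Sum>i\<in>UNIV. of_real (h $ i) * z i)"
      unfolding sum_distrib_left sum_subtractf[symmetric]
      by (intro sum.cong refl) (simp add: N z_def algebra_simps)
    have "(\<Sum>i\<in>UNIV. of_real (S $ k $ i) * z i) = \<mu> * v $ k - t + (\<Sum>i\<in>UNIV. of_real (h $ i) * z i)"
      using 1 unfolding 2 z0 by (simp only: mult_zero_right diff_zero diff_eq_eq)
    then show ?thesis unfolding u_def by (simp add: left_diff_distrib right_diff_distrib)
  qed
  have cnj0: "(\<Sum>k\<in>UNIV. cnj (z k)) = 0" using z0 by (simp flip: cnj_sum)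
  have "(\<Sum>k\<in>UNIV. cnj (z k) * (\<Sum>i\<in>UNIV. of_real (S $ k $ i) * z i)) = (\<Sum>k\<in>UNIV. \<mu> * (cnj (z k) * u k))"
    unfolding Sz distrib_left[of "cnj _"] sum.distrib
    by (simp add: cnj0 mult.left_commute flip: sum_distrib_right)
  also have "\<dots> = \<mu> * of_real (\<Sum>i\<in>UNIV. (cmod (z i))\<^sup>2 / P $ i)"
    unfolding of_real_sum sum_distrib_left
  proof (intro sum.cong refl)
    fix k
    have "of_real ((cmod (z k))\<^sup>2 / P $ k) = cnj (z k) * z k / of_real (P $ k)"
      by (simp add: complex_norm_square mult.commute flip: of_real_power)
    also have "\<dots> = cnj (z k) * u k" using P[of k] by (simp add: z_def)
    finally show "\<mu> * (cnj (z k) * u k) = \<mu> * complex_of_real ((cmod (z k))\<^sup>2 / P $ k)" by simp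
  qed
  finally have 1: "(\<Sum>k\<in>UNIV. cnj (z k) * (\<Sum>i\<in>UNIV. of_real (S $ k $ i) * z i))
      = \<mu> * of_real (\<Sum>i\<in>UNIV. (cmod (z i))\<^sup>2 / P $ i)" .
  \<comment> \<open>The imaginary part is a difference of mixed terms, which cancel by symmetry of
    \<open>S\<close>.\<close>
  have 2: "(\<Sum>k\<in>UNIV. cnj (z k) * (\<Sum>i\<in>UNIV. of_real (S $ k $ i) * z i)) = of_real (x \<bullet> (S *v x) + y \<bullet> (S *v y))"
  proof -
    have Szk: "(\<Sum>i\<in>UNIV. of_real (S $ k $ i) * z i) = Complex ((S *v x) $ k) ((S *v y) $ k)" for k
      by (simp add: complex_eq_iff x_def y_def matrix_vector_mult_def Re_sum Im_sum)
    have "x \<bullet> (S *v y) = y \<bullet> (S *v x)"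
      by (metis sym dot_lmul_matrix inner_commute transpose_matrix_vector)
    then show ?thesis unfolding Szk
      by (simp add: complex_eq_iff Re_sum Im_sum inner_vec_def x_def y_def sum.distrib sum_subtractf sum_negf)
  qed
  show thesis
    by (rule that[OF x0 y0]) (use pos 1 2 Kz in simp_all)
qed

section \<open>Comparison of the spectral radii\<close>

lemma spectrum_mat_1_minus_iff:
  "z \<in> spectrum (mat 1 - N) \<longleftrightarrow>
    (\<exists>v. v \<noteq> 0 \<and> (\<forall>k. (\<Sum>i\<in>UNIV. complex_of_real (N $ k $ i) * v $ i) = (1 - z) * v $ k))"
proof -
  have "(map_matrix complex_of_real (mat 1 - N) *v v) $ k = v $ k - (\<Sum>i\<in>UNIV. complex_of_real (N $ k $ i) * v $ i)" for v k
  proof -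
    have "(map_matrix complex_of_real (mat 1 - N) *v v) $ k
       = (\<Sum>i\<in>UNIV. (if i = k then v $ i else 0) - complex_of_real (N $ k $ i) * v $ i)"
      by (auto simp: matrix_vector_mult_def map_matrix_def mat_def left_diff_distrib intro!: sum.cong)
    then show ?thesis by (simp add: sum_subtractf)
  qed
  then show ?thesis
    by (simp add: spectrum_def vec_eq_iff) (auto simp: algebra_simps)
qed

text \<open>With \<open>\<nu>\<close> the minimal quotient for \<open>P'\<close>, the number
  \<open>1 - \<nu>\<close> is an eigenvalue of \<open>mat 1 - N'\<close>. Each nonzero eigenvalue of
  \<open>mat 1 - N\<close> is \<open>1 - \<mu>\<close> with \<open>\<mu>\<close> a quotient for
  \<open>P\<close>; as \<open>P' \<le> P\<close>, it satisfies
  \<open>\<nu> \<le> \<mu> \<le> 1\<close>. The vectors \<open>e\<close> and \<open>e'\<close> may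
  differ, since they act trivially on zero-sum vectors.\<close>

lemma spectral_radius_mat_1_minus_antimono:
  fixes S N N' :: "real ^ 'm ^ 'm" and P P' e e' h :: "real ^ 'm"
  assumes sym: "transpose S = S" and psd: "\<And>x. 0 \<le> x \<bullet> (S *v x)"
    and P': "\<And>i. 0 < P' $ i" and le: "P' \<le> P"
    and N: "\<And>k i. N $ k $ i = P $ i * (S $ k $ i - e $ k - h $ i)"
    and N': "\<And>k i. N' $ k $ i = P' $ i * (S $ k $ i - e' $ k - h $ i)"
    and nonneg: "\<And>k i. 0 \<le> N $ k $ i" "\<And>k i. 0 \<le> N' $ k $ i"
    and sum1: "\<And>k. (\<Sum>i\<in>UNIV. N $ k $ i) = 1" "\<And>k. (\<Sum>i\<in>UNIV. N' $ k $ i) = 1"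
    and "k \<noteq> (l::'m)"
  shows "spectral_radius (mat 1 - N) \<le> spectral_radius (mat 1 - N')"
proof -
  have P: "0 < P $ i" for i using P'[of i] le by (simp add: less_eq_vec_def less_le_trans)
  have zero: "0 \<in> spectrum (mat 1 - M)" if "\<And>k. (\<Sum>i\<in>UNIV. M $ k $ i) = 1" for M :: "real ^ 'm ^ 'm"
    unfolding spectrum_mat_1_minus_iff
    by (rule exI[of _ 1]) (use that in \<open>simp flip: of_real_sum\<close>)
  \<comment> \<open>A real supremum dominates the members only of a set that is bounded
    above.\<close>
  have bdd: "bdd_above (cmod ` spectrum (mat 1 - N'))"
  proof (rule bdd_aboveI2)
    fix z assume "z \<in> spectrum (mat 1 - N')"
    then obtain v where "v \<noteq> 0" "\<And>k. (\<Sum>i\<in>UNIV. complex_of_real (N' $ k $ i) * v $ i) = (1 - z) * v $ k"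
      unfolding spectrum_mat_1_minus_iff by blast
    then have "cmod (1 - z) \<le> 1" using row_stochastic_eigenvalue_le_1[OF nonneg(2) sum1(2)] by blast
    then show "cmod z \<le> 2" using norm_triangle_sub[of z 1] by (simp add: norm_minus_commute)
  qed
  note upper = cSUP_upper[OF _ bdd, folded spectral_radius_def]
  obtain y \<nu> c where y: "y \<noteq> 0" "entry_sum y = 0"
    and eig: "\<forall>i. (S *v y) $ i = \<nu> * (y $ i / P' $ i) + c"
    and min: "\<forall>x. entry_sum x = 0 \<longrightarrow> \<nu> * (\<Sum>i\<in>UNIV. (x $ i)\<^sup>2 / P' $ i) \<le> x \<bullet> (S *v x)"
    and eq: "\<nu> * (\<Sum>i\<in>UNIV. (y $ i)\<^sup>2 / P' $ i) = y \<bullet> (S *v y)"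
    by (rule min_generalized_eigenvector_on_zero_sum[OF sym P' \<open>k \<noteq> l\<close>])
  have "0 \<le> \<nu>"
  proof -
    obtain i where "y $ i \<noteq> 0" using y(1) by (auto simp: vec_eq_iff)
    then have "0 < (\<Sum>i\<in>UNIV. (y $ i)\<^sup>2 / P' $ i)"
      by (intro sum_pos2[of _ i]) (auto intro!: divide_pos_pos divide_nonneg_pos P')
    then show ?thesis using psd[of y] eq by (metis zero_le_mult_iff not_le)
  qed
  have "of_real (1 - \<nu>) \<in> spectrum (mat 1 - N')"
  \<comment> \<open>For \<open>\<nu> = 1\<close> the shift \<open>t\<close> below has no defining
    equation, but then \<open>1 - \<nu>\<close> is the eigenvalue 0 of the constant vectors.\<close>
  proof (cases "\<nu> = 1")
    case True then show ?thesis using zero[OF sum1(2)] by simp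
  next
    case False
    \<comment> \<open>\<open>N'\<close> maps \<open>y / P'\<close> to \<open>\<nu> * y / P'\<close>
      plus the constant \<open>b\<close> and fixes constants; adding \<open>t\<close> with
      \<open>b + t = \<nu> * t\<close> gives a genuine eigenvector.\<close>
    define b where "b = c - (\<Sum>i\<in>UNIV. h $ i * y $ i)"
    define t where "t = b / (\<nu> - 1)"
    have t: "b + t = \<nu> * t" using False by (simp add: t_def field_simps)
    define u where "u i = y $ i / P' $ i + t" for i
    have Nu: "(\<Sum>i\<in>UNIV. N' $ k $ i * u i) = \<nu> * u k" for k
    proof -
      have "(\<Sum>i\<in>UNIV. N' $ k $ i * u i) = (\<Sum>i\<in>UNIV. N' $ k $ i * (y $ i / P' $ i)) + t"
        by (simp add: u_def distrib_left sum.distrib sum1 flip: sum_distrib_right)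
      also have "(\<Sum>i\<in>UNIV. N' $ k $ i * (y $ i / P' $ i)) =
          (\<Sum>i\<in>UNIV. S $ k $ i * y $ i) - e' $ k * (\<Sum>i\<in>UNIV. y $ i) - (\<Sum>i\<in>UNIV. h $ i * y $ i)"
        unfolding sum_distrib_left sum_subtractf[symmetric]
        using P' by (intro sum.cong refl) (simp add: N' less_imp_neq[symmetric] algebra_simps)
      also have "\<dots> = (S *v y) $ k - (\<Sum>i\<in>UNIV. h $ i * y $ i)"
        using y(2) by (simp add: entry_sum_def matrix_vector_mult_def)
      also have "\<dots> = \<nu> * (y $ k / P' $ k) + b" by (simp add: eig b_def)
      finally show ?thesis using t by (simp add: u_def distrib_left)
    qed
    \<comment> \<open>If \<open>u\<close> vanished, \<open>y\<close> would be a multiple of the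
      positive vector \<open>P'\<close>, which contradicts entry sum 0 and
      \<open>y \<noteq> 0\<close>.\<close>
    have "\<exists>i. u i \<noteq> 0"
    proof (rule ccontr)
      assume u0: "\<not> ?thesis"
      have yt: "y $ i = - t * P' $ i" for i
      proof -
        from u0 have "y $ i / P' $ i = - t" by (simp add: u_def eq_neg_iff_add_eq_0)
        then show ?thesis using P'[of i] by (simp add: divide_eq_eq)
      qed
      have "entry_sum y = - t * (\<Sum>i\<in>UNIV. P' $ i)" by (simp add: entry_sum_def yt sum_distrib_left)
      moreover have "0 < (\<Sum>i\<in>UNIV. P' $ i)" by (intro sum_pos P') auto
      ultimately have "t = 0" using y(2) by simp
      then show False using yt y(1) by (simp add: vec_eq_iff)
    qed
    then have "(\<chi> i. complex_of_real (u i)) \<noteq> 0" by (simp add: vec_eq_iff)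
    then show ?thesis unfolding spectrum_mat_1_minus_iff
      by (intro exI[of _ "\<chi> i. complex_of_real (u i)"] conjI)
         (simp_all add: Nu flip: of_real_mult of_real_sum)
  qed
  from upper[OF this] have rad': "1 - \<nu> \<le> spectral_radius (mat 1 - N')" by (simp del: of_real_diff)
  show ?thesis
  proof (subst (1) spectral_radius_def, rule cSUP_least)
    show "spectrum (mat 1 - N) \<noteq> {}" using zero[OF sum1(1)] by blast
    fix z assume z: "z \<in> spectrum (mat 1 - N)"
    show "cmod z \<le> spectral_radius (mat 1 - N')"
    proof (cases "z = 0")
      case True then show ?thesis using upper[OF zero[OF sum1(2)]] by simp
    next
      case False
      obtain v where v: "v \<noteq> 0" "\<And>k. (\<Sum>i\<in>UNIV. complex_of_real (N $ k $ i) * v $ i) = (1 - z) * v $ k"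
        using z unfolding spectrum_mat_1_minus_iff by blast
      from False have "1 - z \<noteq> 1" by simp
      then obtain x y where xy: "entry_sum x = 0" "entry_sum y = 0"
        and pos: "0 < (\<Sum>i\<in>UNIV. (x $ i)\<^sup>2 / P $ i) + (\<Sum>i\<in>UNIV. (y $ i)\<^sup>2 / P $ i)"
        and ray: "(1 - z) * of_real ((\<Sum>i\<in>UNIV. (x $ i)\<^sup>2 / P $ i) + (\<Sum>i\<in>UNIV. (y $ i)\<^sup>2 / P $ i)) = of_real (x \<bullet> (S *v x) + y \<bullet> (S *v y))"
        by (rule eigenvalue_as_rayleigh_quotient[OF sym P N sum1(1) v])
      define K where "K = (\<Sum>i\<in>UNIV. (x $ i)\<^sup>2 / P $ i) + (\<Sum>i\<in>UNIV. (y $ i)\<^sup>2 / P $ i)"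
      note pos = pos[folded K_def] and ray = ray[folded K_def]
      define \<mu> where "\<mu> = (x \<bullet> (S *v x) + y \<bullet> (S *v y)) / K"
      have \<mu>: "1 - z = of_real \<mu>"
        using ray pos unfolding \<mu>_def of_real_divide by (simp add: eq_divide_eq del: of_real_add)
      have mono: "(\<Sum>i\<in>UNIV. (w $ i)\<^sup>2 / P $ i) \<le> (\<Sum>i\<in>UNIV. (w $ i)\<^sup>2 / P' $ i)" for w :: "real ^ 'm"
        using le P P' by (intro sum_mono divide_left_mono) (auto simp: less_eq_vec_def)
      \<comment> \<open>The larger \<open>P\<close> gives smaller denominators in the quotient;
        \<open>0 \<le> \<nu>\<close> lets the bound for \<open>P'\<close> carry over.\<close>
      have "\<nu> * K \<le> x \<bullet> (S *v x) + y \<bullet> (S *v y)"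
        using min[rule_format, OF xy(1)] min[rule_format, OF xy(2)] mult_left_mono[OF mono[of x] \<open>0 \<le> \<nu>\<close>]
          mult_left_mono[OF mono[of y] \<open>0 \<le> \<nu>\<close>] by (simp add: K_def distrib_left)
      then have "\<nu> \<le> \<mu>" using pos by (simp add: \<mu>_def pos_le_divide_eq)
      moreover have "\<mu> \<le> 1"
        using row_stochastic_eigenvalue_le_1[OF nonneg(1) sum1(1) v] by (simp add: \<mu>)
      moreover have "z = of_real (1 - \<mu>)" using \<mu> by (simp add: algebra_simps)
      then have "cmod z = \<bar>1 - \<mu>\<bar>" by (metis norm_of_real real_norm_def)
      ultimately show ?thesis using rad' by simp
    qed
  qed
qed

section \<open>The rate matrix at the fixed point\<close>

text \<open>Existence is the intermediate value theorem. For uniqueness, wherever the sum is 1 some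
  summand lies strictly above its floor \<open>r $ i\<close>, so the sum increases strictly from
  there.\<close>

lemma normaliser_ex1:
  fixes r :: "real ^ 'm"
  assumes r0: "0 \<le> r" and r1: "entry_sum r < 1" and w: "\<And>i. 0 < w i"
  shows "\<exists>!a. 0 < a \<and> (\<Sum>i\<in>UNIV. max (r $ i) (a * w i)) = 1"
proof -
  define F where "F a = (\<Sum>i\<in>UNIV. max (r $ i) (a * w i))" for a
  have r0': "0 \<le> r $ i" for i using r0 by (simp add: less_eq_vec_def)
  have F0: "F 0 < 1" using r1 r0' by (simp add: F_def entry_sum_def max.absorb1)
  \<comment> \<open>At \<open>b\<close> the summand of one arbitrary index already reaches
    1.\<close>
  define b where "b = 1 / w undefined"
  have "0 < b" using w by (simp add: b_def)
  have "1 = b * w undefined" using w[of undefined] by (simp add: b_def)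
  also have "\<dots> \<le> max (r $ undefined) (b * w undefined)" by simp
  also have "\<dots> \<le> F b" unfolding F_def
    by (rule member_le_sum) (use r0' in \<open>auto simp: max_def intro: order_trans\<close>)
  finally have "1 \<le> F b" .
  moreover have "continuous_on {0..b} F" unfolding F_def by (intro continuous_intros)
  ultimately obtain x where x: "0 \<le> x" "F x = 1"
    using IVT'[of F 0 1 b] F0 \<open>0 < b\<close> by force
  with F0 have "0 < x" by (cases "x = 0") auto
  have uniq: "F c < F d" if "F c = 1" "c < d" for c d
  proof -
    have "\<exists>i. r $ i < c * w i"
    proof (rule ccontr)
      assume "\<not> ?thesis"
      then have "F c = F 0"
        unfolding F_def using r0' by (intro sum.cong refl) (simp add: not_less max.absorb1)
      then show False using F0 \<open>F c = 1\<close> by simp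
    qed
    then obtain i where "r $ i < c * w i" ..
    then have i: "max (r $ i) (c * w i) < max (r $ i) (d * w i)"
      using w[of i] \<open>c < d\<close> by (simp add: less_max_iff_disj)
    moreover have "max (r $ l) (c * w l) \<le> max (r $ l) (d * w l)" for l
      using w[of l] \<open>c < d\<close> by (intro max.mono) auto
    ultimately show ?thesis unfolding F_def by (intro sum_strict_mono_ex1) auto
  qed
  show ?thesis
  proof (rule ex1I[of _ x])
    show "y = x" if "0 < y \<and> (\<Sum>i\<in>UNIV. max (r $ i) (y * w i)) = 1" for y
      using uniq[of x y] uniq[of y x] x that by (fold F_def) force
  qed (use x \<open>0 < x\<close> in \<open>auto simp: F_def\<close>)
qed

lemma weight_pos: "0 < weight W r f p i"
  by (simp add: weight_def)

lemma alpha_unique: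
  assumes "0 \<le> r" "entry_sum r < 1" "0 < a" "(\<Sum>i\<in>UNIV. max (r $ i) (a * weight W r f p i)) = 1"
  shows "alpha W r f p = a"
  unfolding alpha_def
  by (rule the1_equality[OF normaliser_ex1]) (use assms weight_pos in auto)

lemma entry_sum_M_map:
  assumes "0 \<le> r" "entry_sum r < 1"
  shows "entry_sum (M_map W r f p) = 1"
  using theI'[OF normaliser_ex1[OF assms, of "weight W r f p"]]
  by (simp add: M_map_def entry_sum_def alpha_def weight_pos)

section \<open>The modified channel and the factorised weights\<close>

lemma W_tilde_nth:
  "W_tilde W r f $ i $ j =
     (1 + entry_sum f) / (1 - entry_sum r) * (W $ i $ j - (r v* W) $ j) - f $ j"
proof -
  have "((mat 1 - const_rows r) ** W) $ i $ j
      = (\<Sum>k\<in>UNIV. (if k = i then W $ k $ j else 0) - r $ k * W $ k $ j)"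
    by (auto simp: matrix_matrix_mult_def mat_def const_rows_def left_diff_distrib intro!: sum.cong)
  then show ?thesis
    by (simp add: W_tilde_def const_rows_def sum_subtractf vector_matrix_mult_def mult.commute)
qed

lemma sum_W_tilde:
  assumes "stochastic W" "entry_sum r < 1"
  shows "(\<Sum>j\<in>UNIV. W_tilde W r f $ i $ j) = 1"
proof -
  define a where "a = (1 + entry_sum f) / (1 - entry_sum r)"
  have "(\<Sum>j\<in>UNIV. W $ i $ j) = 1" using assms(1) by (simp add: stochastic_def entry_sum_def)
  moreover have "(\<Sum>j\<in>UNIV. (r v* W) $ j) = entry_sum r"
    using entry_sum_vector_matrix[OF assms(1), of r] by (simp add: entry_sum_def)
  moreover have "(\<Sum>j\<in>UNIV. W_tilde W r f $ i $ j)
      = a * ((\<Sum>j\<in>UNIV. W $ i $ j) - (\<Sum>j\<in>UNIV. (r v* W) $ j)) - entry_sum f"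
    unfolding W_tilde_nth a_def[symmetric]
    by (simp add: sum_subtractf entry_sum_def flip: sum_distrib_left)
  ultimately show ?thesis using assms(2) by (simp add: a_def)
qed

definition denom :: "real ^ 'n ^ 'm \<Rightarrow> real ^ 'm \<Rightarrow> real ^ 'n \<Rightarrow> real ^ 'm \<Rightarrow> 'n \<Rightarrow> real" where
  "denom W r f p j = f $ j + (\<Sum>l\<in>UNIV. p $ l * W_tilde W r f $ l $ j)"

text \<open>Collects what is independent of \<open>p\<close> in the weight: a constant factor in all
  later limits and derivatives.\<close>

definition weight_const :: "real ^ 'n ^ 'm \<Rightarrow> real ^ 'm \<Rightarrow> real ^ 'n \<Rightarrow> 'm \<Rightarrow> real" where
  "weight_const W r f i =
     exp (c_coeff W r f i + (\<Sum>j\<in>UNIV. W_tilde W r f $ i $ j * ln (W_tilde W r f $ i $ j)))"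

text \<open>The rows of \<open>W_tilde\<close> sum to 1, so the factor \<open>p $ i\<close> of \<open>Phi\<close> comes out with exponent 1.\<close>

lemma weight_eq:
  assumes "stochastic W" "admissible W r f" "0 < p $ i" and D: "\<And>j. 0 < denom W r f p j"
  shows "weight W r f p i = weight_const W r f i * p $ i *
           exp (- (\<Sum>j\<in>UNIV. W_tilde W r f $ i $ j * ln (denom W r f p j)))"
proof -
  have r1: "entry_sum r < 1" and nn: "0 \<le> W_tilde W r f $ i $ j" for j
    using assms(2) by (auto simp: admissible_def less_eq_vec_def)
  have "W_tilde W r f $ i $ j * ln (Phi W r f p j i) = W_tilde W r f $ i $ j * ln (p $ i)
      + W_tilde W r f $ i $ j * ln (W_tilde W r f $ i $ j) - W_tilde W r f $ i $ j * ln (denom W r f p j)" for j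
  proof (cases "W_tilde W r f $ i $ j = 0")
    case False
    with nn[of j] have "0 < W_tilde W r f $ i $ j" by simp
    then show ?thesis using assms(3) D[of j]
      by (simp add: Phi_def denom_def[symmetric] ln_div ln_mult algebra_simps)
  qed simp
  then have "(\<Sum>j\<in>UNIV. W_tilde W r f $ i $ j * ln (Phi W r f p j i)) = ln (p $ i)
      + (\<Sum>j\<in>UNIV. W_tilde W r f $ i $ j * ln (W_tilde W r f $ i $ j))
      - (\<Sum>j\<in>UNIV. W_tilde W r f $ i $ j * ln (denom W r f p j))"
    by (simp add: sum.distrib sum_subtractf sum_W_tilde[OF assms(1) r1] flip: sum_distrib_right)
  then show ?thesis using assms(3)
    by (simp add: weight_def weight_const_def exp_add exp_diff exp_minus divide_inverse)
qed

text \<open>If no floor is active, the normalising constant is the reciprocal of the total weight.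
  Near the fixed point this replaces the maximum by a smooth formula.\<close>

lemma M_map_eq_normalised_weight:
  assumes "0 \<le> r" "entry_sum r < 1"
    and gt: "\<And>i. r $ i < weight W r f p i / (\<Sum>l\<in>UNIV. weight W r f p l)"
  shows "M_map W r f p $ i = weight W r f p i / (\<Sum>l\<in>UNIV. weight W r f p l)"
proof -
  have pos: "0 < (\<Sum>l\<in>UNIV. weight W r f p l)" by (intro sum_pos weight_pos) auto
  have max: "max (r $ i) (1 / (\<Sum>l\<in>UNIV. weight W r f p l) * weight W r f p i)
      = weight W r f p i / (\<Sum>l\<in>UNIV. weight W r f p l)" for i
    using gt[of i] by simp
  have "alpha W r f p = 1 / (\<Sum>l\<in>UNIV. weight W r f p l)"
    by (rule alpha_unique[OF assms(1,2)], use pos in simp)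
       (unfold max, use pos in \<open>simp flip: sum_divide_distrib\<close>)
  then show ?thesis using max by (simp add: M_map_def)
qed

text \<open>The matrix \<open>S\<close> of the overview, for \<open>q = p v* W\<close>.\<close>

definition weighted_gram :: "real ^ 'n ^ 'm \<Rightarrow> real ^ 'm \<Rightarrow> real ^ 'n \<Rightarrow> real ^ 'm ^ 'm" where
  "weighted_gram W p g =
     (\<chi> k i. (1 + entry_sum g) * (\<Sum>j\<in>UNIV. W $ k $ j * W $ i $ j / (p v* W) $ j))"

text \<open>The vector \<open>h\<close> of the spectral comparison; it stems from the summand
  \<open>- 1 g\<close> of the modified channel.\<close>

definition weighted_rows :: "real ^ 'n ^ 'm \<Rightarrow> real ^ 'm \<Rightarrow> real ^ 'n \<Rightarrow> real ^ 'm" where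
  "weighted_rows W p g = (\<chi> i. \<Sum>j\<in>UNIV. g $ j * W $ i $ j / (p v* W) $ j)"

lemma transpose_weighted_gram: "transpose (weighted_gram W p g) = weighted_gram W p g"
  by (simp add: transpose_def weighted_gram_def vec_eq_iff mult.commute)

text \<open>The form is a weighted sum of squares: \<open>1 + entry_sum g\<close> times the sum over
  \<open>j\<close> of the squared entries of \<open>x v* W\<close> divided by those of
  \<open>p v* W\<close>.\<close>

lemma weighted_gram_nonneg:
  assumes "0 \<le> 1 + entry_sum g" "\<And>j. 0 \<le> (p v* W) $ j"
  shows "0 \<le> x \<bullet> (weighted_gram W p g *v x)"
proof -
  define q where "q = p v* W"
  have "x \<bullet> (weighted_gram W p g *v x)
      = (\<Sum>k\<in>UNIV. \<Sum>i\<in>UNIV. \<Sum>j\<in>UNIV. (1 + entry_sum g) * ((x $ k * W $ k $ j) * (x $ i * W $ i $ j) / q $ j))"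
    by (simp add: inner_vec_def matrix_vector_mult_def weighted_gram_def q_def[symmetric]
        sum_distrib_left sum_distrib_right mult_ac)
  also have "\<dots> = (\<Sum>k\<in>UNIV. \<Sum>j\<in>UNIV. \<Sum>i\<in>UNIV. (1 + entry_sum g) * ((x $ k * W $ k $ j) * (x $ i * W $ i $ j) / q $ j))"
    by (intro sum.cong refl sum.swap)
  also have "\<dots> = (\<Sum>j\<in>UNIV. \<Sum>k\<in>UNIV. \<Sum>i\<in>UNIV. (1 + entry_sum g) * ((x $ k * W $ k $ j) * (x $ i * W $ i $ j) / q $ j))"
    by (rule sum.swap)
  also have "\<dots> = (\<Sum>j\<in>UNIV. (1 + entry_sum g) * ((\<Sum>k\<in>UNIV. x $ k * W $ k $ j)\<^sup>2 / q $ j))"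
    unfolding power2_eq_square sum_product by (simp only: sum_divide_distrib sum_distrib_left)
  also have "0 \<le> \<dots>"
    using assms by (intro sum_nonneg mult_nonneg_nonneg divide_nonneg_nonneg) (auto simp: q_def)
  finally show ?thesis .
qed

section \<open>The fixed point for one parameter pair\<close>

locale common_output =
  fixes W :: "real ^ 'n ^ 'm" and r phat :: "real ^ 'm" and f :: "real ^ 'n"
  assumes stoch: "stochastic W"
    and cols: "\<forall>j. column j W \<noteq> 0"
    and phat_pos: "\<forall>i. 0 < phat $ i"
    and adm: "admissible W r f"
    and out: "final_output W r f phat"
begin

abbreviation V where "V \<equiv> W_tilde W r f"
abbreviation D where "D \<equiv> denom W r f"

definition "s = 1 - entry_sum r"
definition "p = s *\<^sub>R phat + r"
definition "q = phat v* W"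

lemma s_pos: "0 < s" and r_nonneg: "0 \<le> r" and r_nth: "0 \<le> r $ i" and f_nth: "0 \<le> f $ j"
  and V_nonneg: "0 \<le> V $ i $ j" and r_lt_1: "entry_sum r < 1"
  using adm by (auto simp: admissible_def s_def less_eq_vec_def)

lemma p_gt: "r $ i < p $ i"
  using phat_pos s_pos by (simp add: p_def)

lemma p_pos: "0 < p $ i"
  using p_gt[of i] r_nth[of i] by simp

lemma W_nonneg: "0 \<le> W $ i $ j"
  using stoch by (simp add: stochastic_def less_eq_vec_def)

lemma q_pos: "0 < q $ j"
proof -
  obtain i where "W $ i $ j \<noteq> 0"
    using cols by (auto simp: column_def vec_eq_iff)
  with W_nonneg[of i j] have "0 < phat $ i * W $ i $ j" using phat_pos by simp
  moreover have "0 \<le> phat $ l * W $ l $ j" for l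
    using W_nonneg[of l j] phat_pos by (simp add: less_imp_le)
  ultimately have "0 < (\<Sum>l\<in>UNIV. phat $ l * W $ l $ j)"
    by (intro sum_pos2[of _ i]) auto
  then show ?thesis by (simp add: q_def vector_matrix_mult_def mult.commute)
qed

lemma orbit_tendsto_p:
  obtains p0 where "(\<lambda>t. (M_map W r f ^^ t) p0) \<longlonglongrightarrow> p"
proof -
  obtain p0 pstar where lim: "(\<lambda>t. (M_map W r f ^^ t) p0) \<longlonglongrightarrow> pstar"
    and "phat = (1 / (1 - entry_sum r)) *\<^sub>R (pstar - r)"
    using out unfolding final_output_def by blast
  then have "s *\<^sub>R phat = pstar - r" using s_pos unfolding s_def by simp
  then have "pstar = p" by (simp add: p_def)
  with lim that show thesis by blast
qed

text \<open>Every iterate after the first step is normalised, and the entry sum is continuous; so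
  the normalisation of the limit comes from the algorithm.\<close>

lemma sum_p: "(\<Sum>l\<in>UNIV. p $ l) = 1"
proof -
  obtain p0 where lim: "(\<lambda>t. (M_map W r f ^^ t) p0) \<longlonglongrightarrow> p" by (rule orbit_tendsto_p)
  have "(\<lambda>t. entry_sum ((M_map W r f ^^ Suc t) p0)) \<longlonglongrightarrow> entry_sum p"
    unfolding entry_sum_def by (intro tendsto_intros LIMSEQ_Suc lim)
  then have "(\<lambda>t. 1) \<longlonglongrightarrow> entry_sum p"
    by (simp add: entry_sum_M_map[OF r_nonneg r_lt_1])
  from LIMSEQ_unique[OF this tendsto_const] show ?thesis by (simp add: entry_sum_def)
qed

text \<open>The coefficient of \<open>W\<close> in the modified channel is thus determined by
  \<open>g\<close> alone.\<close>

lemma one_plus_g: "1 + entry_sum (g_of W r f) = (1 + entry_sum f) / (1 - entry_sum r)"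
proof -
  have "entry_sum (g_of W r f) = (1 + entry_sum f) / (1 - entry_sum r) * entry_sum (r v* W) + entry_sum f"
    by (simp add: g_of_def entry_sum_def sum.distrib sum_distrib_left)
  then show ?thesis
    using stoch r_lt_1 by (simp add: entry_sum_vector_matrix field_simps)
qed

text \<open>Because \<open>p\<close> sums to 1, the contribution of \<open>- 1 f\<close> cancels
  \<open>f $ j\<close>, and that of \<open>r\<close> to \<open>p v* W\<close> cancels against the
  correction \<open>1 r W\<close>.\<close>

lemma D_p: "D p j = (1 + entry_sum f) * q $ j"
proof -
  have pW: "(\<Sum>l\<in>UNIV. p $ l * W $ l $ j) = s * q $ j + (r v* W) $ j"
    by (simp add: p_def q_def vector_matrix_mult_def sum.distrib sum_distrib_left algebra_simps)
  have "D p j = f $ j + (1 + entry_sum f) / s * ((\<Sum>l\<in>UNIV. p $ l * W $ l $ j) - (\<Sum>l\<in>UNIV. p $ l) * (r v* W) $ j)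
      - (\<Sum>l\<in>UNIV. p $ l) * f $ j"
    by (simp add: denom_def W_tilde_nth right_diff_distrib sum_subtractf sum_distrib_left sum_distrib_right s_def mult_ac)
  then show ?thesis using s_pos by (simp add: sum_p pW)
qed

lemma D_p_pos: "0 < D p j"
proof -
  have "0 \<le> entry_sum f" unfolding entry_sum_def by (intro sum_nonneg f_nth)
  then show ?thesis using q_pos[of j] by (simp add: D_p)
qed

section \<open>Derivatives and limits of the weights at the fixed point\<close>

definition line :: "'m \<Rightarrow> real \<Rightarrow> real ^ 'm" where
  "line k x = (\<chi> l. if l = k then x else p $ l)"

lemma line_p: "line k (p $ k) = p"
  by (auto simp: line_def vec_eq_iff)

text \<open>Logarithmic differentiation: up to a constant, the logarithm of the weight is
  \<open>ln (p $ i)\<close> minus the average of \<open>ln (D p j)\<close> under row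
  \<open>i\<close> of \<open>V\<close>, and \<open>D\<close> is affine in coordinate
  \<open>k\<close> with slope \<open>V $ k $ j\<close>.\<close>

lemma weight_line_deriv:
  "((\<lambda>x. weight W r f (line k x) i) has_real_derivative
     weight W r f p i * ((if i = k then 1 / p $ k else 0) - (\<Sum>j\<in>UNIV. V $ i $ j * V $ k $ j / D p j))) (at (p $ k))"
proof -
  have Dd: "((\<lambda>x. D (line k x) j) has_real_derivative V $ k $ j) (at (p $ k))" for j
  proof -
    have "D (line k x) j = f $ j + (\<Sum>l\<in>UNIV. (if l = k then x * V $ k $ j else 0) + (if l = k then 0 else p $ l * V $ l $ j))" for x
      unfolding denom_def line_def by (simp, intro sum.cong) auto
    then have "D (line k x) j = f $ j + x * V $ k $ j + (\<Sum>l\<in>UNIV. (if l = k then 0 else p $ l * V $ l $ j))" for x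
      by (simp add: sum.distrib)
    then show ?thesis by (auto intro!: derivative_eq_intros)
  qed
  have ld: "((\<lambda>x. line k x $ i) has_real_derivative (if i = k then 1 else 0)) (at (p $ k))"
    by (auto simp: line_def)
  have Dp: "0 < D (line k (p $ k)) j" for j by (simp add: line_p D_p_pos)
  have "((\<lambda>x. weight_const W r f i * line k x $ i * exp (- (\<Sum>j\<in>UNIV. V $ i $ j * ln (D (line k x) j))))
     has_real_derivative
     weight W r f p i * ((if i = k then 1 / p $ k else 0) - (\<Sum>j\<in>UNIV. V $ i $ j * V $ k $ j / D p j))) (at (p $ k))"
    apply (rule derivative_eq_intros ld Dd refl Dp)+
    using p_pos[of k]
    by (simp add: line_p weight_eq[OF stoch adm p_pos D_p_pos] divide_inverse algebra_simps)
  \<comment> \<open>The factorised formula needs positive coordinates and denominators, which are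
    available only in a neighbourhood of \<open>p\<close>.\<close>
  moreover have "eventually (\<lambda>x. weight_const W r f i * line k x $ i * exp (- (\<Sum>j\<in>UNIV. V $ i $ j * ln (D (line k x) j)))
        = weight W r f (line k x) i) (nhds (p $ k))"
  proof -
    have "eventually (\<lambda>x. 0 < D (line k x) j) (nhds (p $ k))" for j
      using order_tendstoD(1)[OF isContD[OF DERIV_isCont[OF Dd]] Dp]
      by (simp add: eventually_nhds_conv_at Dp)
    moreover have "eventually (\<lambda>x. 0 < line k x $ i) (nhds (p $ k))"
      using order_tendstoD(1)[OF isContD[OF DERIV_isCont[OF ld]], of 0] p_pos[of i]
      by (simp add: eventually_nhds_conv_at line_p)
    ultimately have "eventually (\<lambda>x. (\<forall>j. 0 < D (line k x) j) \<and> 0 < line k x $ i) (nhds (p $ k))"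
      by (simp add: eventually_conj_iff eventually_all_finite)
    then show ?thesis
      by (rule eventually_mono) (simp add: weight_eq[OF stoch adm])
  qed
  ultimately show ?thesis
    by (simp add: DERIV_cong_ev)
qed

lemma weight_tendsto:
  assumes lim: "x \<longlonglongrightarrow> p"
  shows "(\<lambda>t. weight W r f (x t) i) \<longlonglongrightarrow> weight W r f p i"
proof -
  have xl: "(\<lambda>t. x t $ i) \<longlonglongrightarrow> p $ i" for i by (intro tendsto_intros lim)
  have Dl: "(\<lambda>t. D (x t) j) \<longlonglongrightarrow> D p j" for j
    unfolding denom_def by (intro tendsto_intros lim)
  have "(\<lambda>t. weight_const W r f i * x t $ i * exp (- (\<Sum>j\<in>UNIV. V $ i $ j * ln (D (x t) j))))
      \<longlonglongrightarrow> weight W r f p i"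
    unfolding weight_eq[OF stoch adm p_pos D_p_pos]
    by (intro tendsto_intros xl Dl) (use D_p_pos in \<open>simp add: less_imp_neq[symmetric]\<close>)
  moreover have "eventually (\<lambda>t. (\<forall>j. 0 < D (x t) j) \<and> 0 < x t $ i) sequentially"
    using order_tendstoD(1)[OF Dl D_p_pos] order_tendstoD(1)[OF xl p_pos]
    by (simp add: eventually_conj_iff eventually_all_finite)
  then have "eventually (\<lambda>t. weight_const W r f i * x t $ i * exp (- (\<Sum>j\<in>UNIV. V $ i $ j * ln (D (x t) j)))
      = weight W r f (x t) i) sequentially"
    by (rule eventually_mono) (simp add: weight_eq[OF stoch adm])
  ultimately show ?thesis by (rule Lim_transform_eventually)
qed

text \<open>The fixed point equation is extracted from convergence of the orbit: since the limit
  lies strictly above \<open>r\<close>, the maximum is eventually inactive, and the iteration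
  without it passes to the limit.\<close>

lemma p_proportional_weight:
  obtains c where "\<forall>i. p $ i = c * weight W r f p i"
proof -
  obtain p0 where lim: "(\<lambda>t. (M_map W r f ^^ t) p0) \<longlonglongrightarrow> p" by (rule orbit_tendsto_p)
  define x where "x t = (M_map W r f ^^ t) p0" for t
  have lim: "x \<longlonglongrightarrow> p" using lim by (simp add: x_def[abs_def])
  have step: "x (Suc t) $ i = max (r $ i) (alpha W r f (x t) * weight W r f (x t) i)" for t i
    by (simp add: x_def M_map_def)
  have xl: "(\<lambda>t. x (Suc t) $ i) \<longlonglongrightarrow> p $ i" for i by (intro tendsto_intros LIMSEQ_Suc lim)
  have ev: "eventually (\<lambda>t. x (Suc t) $ i = alpha W r f (x t) * weight W r f (x t) i) sequentially" for i
    using order_tendstoD(1)[OF xl p_gt] by (rule eventually_mono) (auto simp: step max_def split: if_splits)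
  note wl = weight_tendsto[OF lim]
  define i0 :: 'm where "i0 = undefined"
  \<comment> \<open>Convergence of the normalising constants is read off from one coordinate, where
    they are eventually this quotient.\<close>
  have "(\<lambda>t. x (Suc t) $ i0 / weight W r f (x t) i0) \<longlonglongrightarrow> p $ i0 / weight W r f p i0"
    by (intro tendsto_intros xl wl) (use weight_pos[of W r f p i0] in simp)
  moreover have "eventually (\<lambda>t. x (Suc t) $ i0 / weight W r f (x t) i0 = alpha W r f (x t)) sequentially"
    using ev[of i0] by (rule eventually_mono) (use weight_pos[of W r f _ i0] in \<open>simp add: less_imp_neq[symmetric]\<close>)
  ultimately have al: "(\<lambda>t. alpha W r f (x t)) \<longlonglongrightarrow> p $ i0 / weight W r f p i0"
    by (rule Lim_transform_eventually)
  show thesis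
  proof (rule that, rule allI)
    fix i
    have "(\<lambda>t. x (Suc t) $ i) \<longlonglongrightarrow> p $ i0 / weight W r f p i0 * weight W r f p i"
      by (rule Lim_transform_eventually[OF tendsto_mult[OF al wl]]) (use ev[of i] in \<open>simp add: eq_commute\<close>)
    with xl show "p $ i = p $ i0 / weight W r f p i0 * weight W r f p i"
      by (rule LIMSEQ_unique)
  qed
qed

lemma p_eq_normalised: "p $ i = weight W r f p i / (\<Sum>l\<in>UNIV. weight W r f p l)"
proof -
  obtain c where c: "\<forall>i. p $ i = c * weight W r f p i" by (rule p_proportional_weight)
  have "1 = c * (\<Sum>l\<in>UNIV. weight W r f p l)"
    unfolding sum_p[symmetric] by (simp add: c sum_distrib_left)
  then have "c = 1 / (\<Sum>l\<in>UNIV. weight W r f p l)"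
    by (metis eq_divide_eq mult_zero_right zero_neq_one)
  then show ?thesis using c by simp
qed

text \<open>Near \<open>p\<close> the map is the normalised weight. The quotient rule gives
  \<open>p $ i\<close> times the logarithmic derivative \<open>L i\<close> minus its
  \<open>p\<close>-mean, and that mean is evaluated through the definition of
  \<open>D\<close>.\<close>

lemma matrix_rate_p:
  "matrix_rate W r f p $ k $ i
     = (if i = k then 1 else 0) - p $ i * (\<Sum>j\<in>UNIV. V $ k $ j * (V $ i $ j + f $ j) / D p j)"
proof -
  define w where "w i = weight W r f p i" for i
  define L where "L i = (if i = k then 1 / p $ k else 0) - (\<Sum>j\<in>UNIV. V $ i $ j * V $ k $ j / D p j)" for i
  have dw: "((\<lambda>x. weight W r f (line k x) i) has_real_derivative w i * L i) (at (p $ k))" for i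
    unfolding w_def L_def by (rule weight_line_deriv)
  define Z where "Z = (\<Sum>l\<in>UNIV. w l)"
  have Z: "0 < Z" unfolding Z_def w_def by (intro sum_pos weight_pos) auto
  have pw: "p $ i = w i / Z" for i unfolding w_def Z_def by (rule p_eq_normalised)
  define G where "G x i = weight W r f (line k x) i / (\<Sum>l\<in>UNIV. weight W r f (line k x) l)" for x i
  have Gp: "G (p $ k) i = p $ i" for i unfolding G_def line_p by (rule p_eq_normalised[symmetric])
  have dG: "((\<lambda>x. G x i) has_real_derivative p $ i * (L i - (\<Sum>l\<in>UNIV. p $ l * L l))) (at (p $ k))" for i
  proof -
    have "((\<lambda>x. G x i) has_real_derivative (w i * L i * Z - w i * (\<Sum>l\<in>UNIV. w l * L l)) / (Z * Z)) (at (p $ k))"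
      unfolding G_def
      using Z by (auto intro!: derivative_eq_intros dw simp: line_p Z_def w_def)
    moreover have "(w i * L i * Z - w i * (\<Sum>l\<in>UNIV. w l * L l)) / (Z * Z) = p $ i * (L i - (\<Sum>l\<in>UNIV. p $ l * L l))"
    proof -
      have "(\<Sum>l\<in>UNIV. p $ l * L l) = (\<Sum>l\<in>UNIV. w l * L l) / Z"
        by (simp add: pw sum_divide_distrib)
      then show ?thesis using Z by (simp add: pw field_simps)
    qed
    ultimately show ?thesis by simp
  qed
  \<comment> \<open>All floors must be inactive simultaneously, since the normalising constant
    couples the coordinates.\<close>
  have "eventually (\<lambda>x. r $ i < G x i) (nhds (p $ k))" for i
    using order_tendstoD(1)[OF isContD[OF DERIV_isCont[OF dG[of i]]], of "r $ i"] p_gt[of i]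
    by (simp add: eventually_nhds_conv_at Gp)
  then have "eventually (\<lambda>x. \<forall>i. r $ i < G x i) (nhds (p $ k))"
    by (simp add: eventually_all_finite)
  then have "eventually (\<lambda>x. G x i = M_map W r f (line k x) $ i) (nhds (p $ k))"
    by (rule eventually_mono)
       (simp add: G_def M_map_eq_normalised_weight[OF r_nonneg r_lt_1])
  from DERIV_cong_ev[OF refl this refl] dG[of i]
  have "((\<lambda>x. M_map W r f (line k x) $ i) has_real_derivative p $ i * (L i - (\<Sum>l\<in>UNIV. p $ l * L l))) (at (p $ k))"
    by simp
  then have "matrix_rate W r f p $ k $ i = p $ i * (L i - (\<Sum>l\<in>UNIV. p $ l * L l))"
    unfolding matrix_rate_def by (simp add: DERIV_imp_deriv line_def)
  also have "(\<Sum>l\<in>UNIV. p $ l * L l) = (\<Sum>j\<in>UNIV. V $ k $ j * f $ j / D p j)"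
  proof -
    have "(\<Sum>l\<in>UNIV. p $ l * L l) = (\<Sum>l\<in>UNIV. (if l = k then 1 else 0) - (\<Sum>j\<in>UNIV. (p $ l * V $ l $ j) * (V $ k $ j / D p j)))"
      using p_pos[of k] by (intro sum.cong refl) (auto simp: L_def right_diff_distrib sum_distrib_left mult_ac)
    also have "\<dots> = 1 - (\<Sum>j\<in>UNIV. (\<Sum>l\<in>UNIV. p $ l * V $ l $ j) * (V $ k $ j / D p j))"
      unfolding sum_subtractf by (subst sum.swap) (simp add: sum_distrib_right sum_divide_distrib)
    also have "\<dots> = (\<Sum>j\<in>UNIV. V $ k $ j) - (\<Sum>j\<in>UNIV. (D p j - f $ j) * (V $ k $ j / D p j))"
      by (simp add: sum_W_tilde[OF stoch r_lt_1] denom_def)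
    also have "\<dots> = (\<Sum>j\<in>UNIV. V $ k $ j * f $ j / D p j)"
      unfolding sum_subtractf[symmetric]
    proof (intro sum.cong refl)
      fix j show "V $ k $ j - (D p j - f $ j) * (V $ k $ j / D p j) = V $ k $ j * f $ j / D p j"
        using D_p_pos[of j] by (simp add: field_simps)
    qed
    finally show ?thesis .
  qed
  also have "p $ i * (L i - (\<Sum>j\<in>UNIV. V $ k $ j * f $ j / D p j)) =
     (if i = k then 1 else 0) - p $ i * ((\<Sum>j\<in>UNIV. V $ i $ j * V $ k $ j / D p j) + (\<Sum>j\<in>UNIV. V $ k $ j * f $ j / D p j))"
    using p_pos[of k] by (auto simp: L_def algebra_simps)
  also have "(\<Sum>j\<in>UNIV. V $ i $ j * V $ k $ j / D p j) + (\<Sum>j\<in>UNIV. V $ k $ j * f $ j / D p j)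
     = (\<Sum>j\<in>UNIV. V $ k $ j * (V $ i $ j + f $ j) / D p j)"
    unfolding sum.distrib[symmetric] by (intro sum.cong refl) (simp add: add_divide_distrib algebra_simps)
  finally show ?thesis .
qed

text \<open>Puts \<open>N\<close> into the form required by the spectral comparison. For fixed
  \<open>g\<close>, \<open>r\<close> survives only in the factor
  \<open>phat + r / (1 - r\<^sub>+)\<close>, written \<open>P\<close> in the overview, and in the
  shift \<open>e\<close>, which is constant along each row.\<close>

lemma matrix_rate_decomp:
  "\<exists>N e. matrix_rate W r f p = mat 1 - N \<and> (\<forall>k i. 0 \<le> N $ k $ i) \<and> (\<forall>k. (\<Sum>i\<in>UNIV. N $ k $ i) = 1) \<and>
     (\<forall>k i. N $ k $ i = (phat + (1 / (1 - entry_sum r)) *\<^sub>R r) $ i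
       * (weighted_gram W phat (g_of W r f) $ k $ i - e $ k - weighted_rows W phat (g_of W r f) $ i))"
proof (intro exI conjI allI)
  define e where "e = (\<chi> k. \<Sum>j\<in>UNIV. V $ k $ j * (r v* W) $ j / q $ j)"
  define N where "N = (\<chi> k i. p $ i * (\<Sum>j\<in>UNIV. V $ k $ j * (V $ i $ j + f $ j) / D p j))"
  show "matrix_rate W r f p = mat 1 - N"
    by (auto simp: vec_eq_iff matrix_rate_p N_def mat_def)
  show "0 \<le> N $ k $ i" for k i
    by (auto simp: N_def intro!: mult_nonneg_nonneg sum_nonneg divide_nonneg_nonneg add_nonneg_nonneg
        V_nonneg f_nth less_imp_le[OF p_pos] less_imp_le[OF D_p_pos])
  show "(\<Sum>i\<in>UNIV. N $ k $ i) = 1" for k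
  proof -
    have "(\<Sum>i\<in>UNIV. N $ k $ i) = (\<Sum>i\<in>UNIV. \<Sum>j\<in>UNIV. V $ k $ j / D p j * (p $ i * V $ i $ j + p $ i * f $ j))"
      unfolding N_def vec_lambda_beta sum_distrib_left
      by (intro sum.cong refl) (simp add: add_divide_distrib algebra_simps)
    also have "\<dots> = (\<Sum>j\<in>UNIV. V $ k $ j / D p j * (\<Sum>i\<in>UNIV. p $ i * V $ i $ j + p $ i * f $ j))"
      by (subst sum.swap) (simp only: sum_distrib_left)
    also have "\<dots> = (\<Sum>j\<in>UNIV. V $ k $ j / D p j * D p j)"
      by (simp only: sum.distrib sum_distrib_right[symmetric] sum_p denom_def) (simp add: add.commute)
    also have "\<dots> = 1"
      using D_p_pos by (simp add: less_imp_neq[symmetric] sum_W_tilde[OF stoch r_lt_1])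
    finally show ?thesis .
  qed
  show "N $ k $ i = (phat + (1 / (1 - entry_sum r)) *\<^sub>R r) $ i
       * (weighted_gram W phat (g_of W r f) $ k $ i - e $ k - weighted_rows W phat (g_of W r f) $ i)" for k i
  proof -
    \<comment> \<open>The factor \<open>s\<close> split off here cancels against the one contained
      in \<open>D p j\<close>.\<close>
    have p_eq: "p $ i = s * (phat + (1 / (1 - entry_sum r)) *\<^sub>R r) $ i"
      using s_pos by (simp add: p_def s_def[symmetric] distrib_left)
    have summand: "s * (V $ k $ j * (V $ i $ j + f $ j) / D p j)
        = (1 + entry_sum (g_of W r f)) * (W $ k $ j * W $ i $ j / q $ j)
          - V $ k $ j * (r v* W) $ j / q $ j - g_of W r f $ j * W $ i $ j / q $ j" for j
    proof -
      define a where "a = (1 + entry_sum f) / s"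
      have "0 \<le> entry_sum f" unfolding entry_sum_def by (intro sum_nonneg f_nth)
      then have a: "0 < a" "1 + entry_sum f = a * s" using s_pos by (simp_all add: a_def)
      \<comment> \<open>The two factors of the summand are rewritten differently: this form for
        index \<open>i\<close>, the next one, which involves only \<open>g\<close>, for index
        \<open>k\<close>.\<close>
      have Vf: "V $ l $ j + f $ j = a * (W $ l $ j - (r v* W) $ j)" for l
        by (simp add: W_tilde_nth a_def s_def)
      have Vg: "V $ l $ j = a * W $ l $ j - g_of W r f $ j" for l
        by (simp add: W_tilde_nth a_def s_def g_of_def right_diff_distrib)
      have "s * (V $ k $ j * (V $ i $ j + f $ j) / D p j) = V $ k $ j * (W $ i $ j - (r v* W) $ j) / q $ j"
        using a s_pos q_pos[of j] by (simp add: Vf D_p)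
      also have "\<dots> = V $ k $ j * W $ i $ j / q $ j - V $ k $ j * (r v* W) $ j / q $ j"
        by (simp add: right_diff_distrib diff_divide_distrib)
      also have "V $ k $ j * W $ i $ j / q $ j = a * (W $ k $ j * W $ i $ j / q $ j) - g_of W r f $ j * W $ i $ j / q $ j"
        by (simp add: Vg left_diff_distrib diff_divide_distrib)
      finally show ?thesis
        by (simp add: one_plus_g[unfolded s_def[symmetric] a_def[symmetric]])
    qed
    have "N $ k $ i = (phat + (1 / (1 - entry_sum r)) *\<^sub>R r) $ i
        * (\<Sum>j\<in>UNIV. s * (V $ k $ j * (V $ i $ j + f $ j) / D p j))"
      by (simp only: N_def vec_lambda_beta p_eq sum_distrib_left[symmetric]) (simp add: mult_ac)
    then show ?thesis
      unfolding summand sum_subtractf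
      by (simp only: weighted_gram_def weighted_rows_def e_def q_def[symmetric] vec_lambda_beta sum_distrib_left[symmetric])
  qed
qed

end

section \<open>Monotonicity of the global rate\<close>

theorem theorem4:
  fixes W :: "real ^ 'n ^ 'm"
    and phat r r' :: "real ^ 'm"
    and g :: "real ^ 'n"
  assumes "stochastic W"
    and "\<exists>i k. row i W \<noteq> row k W"
    and "\<forall>j. column j W \<noteq> 0"
    and "\<forall>i. 0 < phat $ i"
    and "g_admissible W r g"
    and "g_admissible W r' g"
    and "final_output W r (f_of W r g) phat"
    and "final_output W r' (f_of W r' g) phat"
    and "(1 / (1 - entry_sum r)) *\<^sub>R r \<ge> (1 / (1 - entry_sum r')) *\<^sub>R r'"
  shows "global_rate_g W phat r g \<le> global_rate_g W phat r' g"
proof -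
  define \<rho> where "\<rho> r = (1 / (1 - entry_sum r)) *\<^sub>R r" for r :: "real ^ 'm"
  define S where "S = weighted_gram W phat g"
  define h where "h = weighted_rows W phat g"
  have setting: "\<exists>f. g = g_of W r f \<and> f_of W r g = f \<and> common_output W r phat f"
    if "g_admissible W r g" and out: "final_output W r (f_of W r g) phat" for r
  proof -
    obtain f where adm: "admissible W r f" and g: "g = g_of W r f"
      using \<open>g_admissible W r g\<close> unfolding g_admissible_def by blast
    have f: "f_of W r g = f"
      unfolding g using f_of_g_of[OF assms(1)] adm by (simp add: admissible_def)
    have "common_output W r phat f"
      by unfold_locales (use assms(1,3,4) adm out f in simp_all)
    with g f show ?thesis by blast
  qed
  \<comment> \<open>\<open>S\<close> and \<open>h\<close> are fixed before \<open>r\<close> is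
    chosen, so both rate matrices share them.\<close>
  have rate: "\<exists>N e. matrix_rate W r (f_of W r g) ((1 - entry_sum r) *\<^sub>R phat + r) = mat 1 - N
      \<and> (\<forall>k i. 0 \<le> N $ k $ i) \<and> (\<forall>k. (\<Sum>i\<in>UNIV. N $ k $ i) = 1)
      \<and> (\<forall>k i. N $ k $ i = (phat + \<rho> r) $ i * (S $ k $ i - e $ k - h $ i))"
    if sol: "g_admissible W r g" "final_output W r (f_of W r g) phat" for r
  proof -
    obtain f where g: "g = g_of W r f" and f: "f_of W r g = f" and "common_output W r phat f"
      using setting[OF sol] by blast
    then interpret common_output W r phat f by simp
    show ?thesis
      using matrix_rate_decomp[folded g] unfolding f p_def s_def S_def h_def \<rho>_def .
  qed
  obtain N e where N: "matrix_rate W r (f_of W r g) ((1 - entry_sum r) *\<^sub>R phat + r) = mat 1 - N"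
      "\<forall>k i. 0 \<le> N $ k $ i" "\<forall>k. (\<Sum>i\<in>UNIV. N $ k $ i) = 1"
      "\<forall>k i. N $ k $ i = (phat + \<rho> r) $ i * (S $ k $ i - e $ k - h $ i)"
    using rate[OF assms(5,7)] by (elim exE conjE)
  obtain N' e' where N': "matrix_rate W r' (f_of W r' g) ((1 - entry_sum r') *\<^sub>R phat + r') = mat 1 - N'"
      "\<forall>k i. 0 \<le> N' $ k $ i" "\<forall>k. (\<Sum>i\<in>UNIV. N' $ k $ i) = 1"
      "\<forall>k i. N' $ k $ i = (phat + \<rho> r') $ i * (S $ k $ i - e' $ k - h $ i)"
    using rate[OF assms(6,8)] by (elim exE conjE)
  obtain f' where g: "g = g_of W r' f'" and "common_output W r' phat f'"
    using setting[OF assms(6,8)] by blast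
  then interpret common_output W r' phat f' by simp
  have "0 \<le> entry_sum f'" unfolding entry_sum_def by (intro sum_nonneg f_nth)
  then have g0: "0 \<le> 1 + entry_sum g" unfolding g one_plus_g using r_lt_1 by simp
  \<comment> \<open>Unequal rows supply two distinct indices, so that the zero-sum hyperplane is
    nontrivial.\<close>
  obtain k l :: 'm where "row k W \<noteq> row l W" using assms(2) by blast
  then have "k \<noteq> l" by auto
  have "spectral_radius (mat 1 - N) \<le> spectral_radius (mat 1 - N')"
  proof (rule spectral_radius_mat_1_minus_antimono[OF _ _ _ _ N(4)[rule_format] N'(4)[rule_format]
      N(2)[rule_format] N'(2)[rule_format] N(3)[rule_format] N'(3)[rule_format] \<open>k \<noteq> l\<close>])
    show "transpose S = S" unfolding S_def by (rule transpose_weighted_gram)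
    show "0 \<le> x \<bullet> (S *v x)" for x
      unfolding S_def using g0 q_pos by (intro weighted_gram_nonneg) (simp_all add: q_def less_imp_le)
    show "0 < (phat + \<rho> r') $ i" for i
      using assms(4) r_nth r_lt_1 by (simp add: \<rho>_def less_eq_vec_def add_pos_nonneg)
    show "phat + \<rho> r' \<le> phat + \<rho> r"
      using assms(9) by (simp add: \<rho>_def less_eq_vec_def)
  qed
  then show ?thesis by (simp add: global_rate_g_def global_rate_def N(1) N'(1))
qed

end
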